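(* Let $\mathbb{K}$ be an algebraically closed field of characteristic $0$, let $(\mathcal{A},\mu_0)$ be a left alternative $\mathbb{K}$-algebra, and let $\mu_t=\sum_{i\ge 0}\mu_i t^i$ be a formal left alternative deformation of $(\mathcal{A},\mu_0)$. Suppose $p\ge 1$ and $\mu_p$ is the first non-zero coefficient after $\mu_0$ in $\mu_t$, i.e. $\mu_1=\cdots=\mu_{p-1}=0$ and $\mu_p\neq 0$. Then $\mu_p$ is a 2-cocycle of the left alternative algebra cohomology of $\mathcal{A}$ with coefficients in itself, i.e. $\delta^2\mu_p=0$.
   Context: A left alternative $\mathbb{K}$-algebra is a $\mathbb{K}$-vector space $\mathcal{A}$ with a bilinear multiplication $\mu_0$ (not assumed associative or unital) satisfying $\mu_0(x,\mu_0(x,y))=\mu_0(\mu_0(x,x),y)$ for all $x,y$. A formal left alternative deformation of $(\mathcal{A},\mu_0)$ is a $\mathbb{K}[[t]]$-bilinear map $\mu_t:\mathcal{A}[[t]]\times\mathcal{A}[[t]]\to\mathcal{A}[[t]]$ of the form $\mu_t=\sum_{i\ge 0}\mu_i t^i$, with each $\mu_i:\mathcal{A}\times\mathcal{A}\to\mathcal{A}$ a $\mathbb{K}$-bilinear map extended $\mathbb{K}[[t]]$-bilinearly (via $\mu_i(\sum_j a_jt^j,\sum_k b_kt^k)=\sum_{j,k}t^{j+k}\mu_i(a_j,b_k)$) and with $\mu_0$ the given multiplication, such that for all $x,y,z\in\mathcal{A}$: $\mu_t(x,\mu_t(y,z))-\mu_t(\mu_t(x,y),z)+\mu_t(y,\mu_t(x,z))-\mu_t(\mu_t(y,x),z)=0$.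 Bilinear maps are identified with linear maps $\mathcal{A}^{\otimes 2}\to\mathcal{A}$ (2-cochains). For such $\phi$, $\delta^2\phi=[\mu_0\circ(\phi\otimes\mathrm{id}-\mathrm{id}\otimes\phi)+\phi\circ(\mu_0\otimes\mathrm{id}-\mathrm{id}\otimes\mu_0)]\circ(\mathrm{id}^{\otimes 3}+\sigma_1)$, where $\sigma_1(x\otimes y\otimes z)=y\otimes x\otimes z$. A 2-cocycle is a $\phi$ with $\delta^2\phi=0$. *)

theory Defs
  imports
    "HOL-Computational_Algebra.Polynomial"
    "HOL-Computational_Algebra.Formal_Power_Series"
begin

text \<open>
  Over a field, \<^const>\<open>module_hom\<close> coincides with \<^const>\<open>Vector_Spaces.linear\<close>
  (fact \<open>module_hom_iff_linear\<close>); the module version is used because bilinearity is also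
  needed over the ring \<open>K[[t]]\<close>.
\<close>

definition bilinear_map ::
  "('r::comm_ring_1 \<Rightarrow> 'a::ab_group_add \<Rightarrow> 'a) \<Rightarrow> ('a \<Rightarrow> 'a \<Rightarrow> 'a) \<Rightarrow> bool" where
  "bilinear_map scale B \<longleftrightarrow>
     (\<forall>x. module_hom scale scale (\<lambda>y. B x y)) \<and> (\<forall>y. module_hom scale scale (\<lambda>x. B x y))"

locale left_alternative_algebra = vector_space scale
  for scale :: "'k::field \<Rightarrow> 'a::ab_group_add \<Rightarrow> 'a" +
  fixes mul :: "'a \<Rightarrow> 'a \<Rightarrow> 'a"
  assumes bilinear_mul: "bilinear_map scale mul"
    and left_alternative: "mul x (mul x y) = mul (mul x x) y"


subsection \<open>Formal deformations\<close>

text \<open>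
  \<open>A[[t]]\<close> is the type \<open>'a fps\<close>, for which only the additive structure is used;
  \<open>fps_const\<close> embeds \<open>A\<close> into it.
\<close>

definition fps_scale ::
  "('k::comm_ring_1 \<Rightarrow> 'a::ab_group_add \<Rightarrow> 'a) \<Rightarrow> 'k fps \<Rightarrow> 'a fps \<Rightarrow> 'a fps" where
  "fps_scale scale c f = Abs_fps (\<lambda>n. \<Sum>i=0..n. scale (fps_nth c i) (fps_nth f (n - i)))"

text \<open>\<open>B (\<Sum>\<^sub>j a\<^sub>j t\<^sup>j) (\<Sum>\<^sub>k b\<^sub>k t\<^sup>k) = \<Sum>\<^sub>j\<^sub>k B a\<^sub>j b\<^sub>k t\<^sup>j\<^sup>+\<^sup>k\<close>\<close>

definition fps_extension ::
  "('a::ab_group_add \<Rightarrow> 'a \<Rightarrow> 'a) \<Rightarrow> 'a fps \<Rightarrow> 'a fps \<Rightarrow> 'a fps" where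
  "fps_extension B f g = Abs_fps (\<lambda>n. \<Sum>j=0..n. B (fps_nth f j) (fps_nth g (n - j)))"

text \<open>
  The map \<open>\<Sum>\<^sub>i \<mu>\<^sub>i t\<^sup>i\<close>, each \<open>\<mu>\<^sub>i\<close> being extended as above. The summand \<open>t\<^sup>i \<mu>\<^sub>i f g\<close> contributes
  to the coefficient of \<open>t\<^sup>n\<close> only when \<open>i \<le> n\<close>.
\<close>

definition fps_bilinear_series ::
  "(nat \<Rightarrow> 'a::ab_group_add \<Rightarrow> 'a \<Rightarrow> 'a) \<Rightarrow> 'a fps \<Rightarrow> 'a fps \<Rightarrow> 'a fps" where
  "fps_bilinear_series \<mu> f g =
     Abs_fps (\<lambda>n. \<Sum>i=0..n. fps_nth (fps_extension (\<mu> i) f g) (n - i))"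

text \<open>
  The bilinearity over \<open>K[[t]]\<close> required here is implied by the other conditions; see
  \<open>bilinear_map_fps_bilinear_series\<close> below.
\<close>

definition formal_left_alternative_deformation ::
  "('k::field \<Rightarrow> 'a::ab_group_add \<Rightarrow> 'a) \<Rightarrow> ('a \<Rightarrow> 'a \<Rightarrow> 'a) \<Rightarrow>
   (nat \<Rightarrow> 'a \<Rightarrow> 'a \<Rightarrow> 'a) \<Rightarrow> ('a fps \<Rightarrow> 'a fps \<Rightarrow> 'a fps) \<Rightarrow> bool" where
  "formal_left_alternative_deformation scale mul \<mu> \<mu>t \<longleftrightarrow>
     bilinear_map (fps_scale scale) \<mu>t \<and>
     (\<forall>i. bilinear_map scale (\<mu> i)) \<and>
     \<mu>t = fps_bilinear_series \<mu> \<and>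
     \<mu> 0 = mul \<and>
     (\<forall>a b c. let x = fps_const a; y = fps_const b; z = fps_const c in
        \<mu>t x (\<mu>t y z) - \<mu>t (\<mu>t x y) z + \<mu>t y (\<mu>t x z) - \<mu>t (\<mu>t y x) z = 0)"


subsection \<open>Cocycles\<close>

text \<open>
  Linear maps out of a tensor power of \<open>A\<close> are represented by the corresponding multilinear
  functions, i.e. by their values on pure tensors. Since \<open>(id + \<sigma>\<^sub>1) (x \<otimes> y \<otimes> z)\<close> is the sum of two
  pure tensors, composing with \<open>id + \<sigma>\<^sub>1\<close> symmetrizes in the first two arguments.
\<close>

definition comp_id_plus_sigma1 ::
  "('a \<Rightarrow> 'a \<Rightarrow> 'a \<Rightarrow> 'b::ab_group_add) \<Rightarrow> 'a \<Rightarrow> 'a \<Rightarrow> 'a \<Rightarrow> 'b" where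
  "comp_id_plus_sigma1 F x y z = F x y z + F y x z"

definition delta2 ::
  "('a::ab_group_add \<Rightarrow> 'a \<Rightarrow> 'a) \<Rightarrow> ('a \<Rightarrow> 'a \<Rightarrow> 'a) \<Rightarrow> 'a \<Rightarrow> 'a \<Rightarrow> 'a \<Rightarrow> 'a" where
  "delta2 mul \<phi> = comp_id_plus_sigma1 (\<lambda>x y z.
     (mul (\<phi> x y) z - mul x (\<phi> y z)) + (\<phi> (mul x y) z - \<phi> x (mul y z)))"

definition two_cocycle ::
  "('k::field \<Rightarrow> 'a::ab_group_add \<Rightarrow> 'a) \<Rightarrow> ('a \<Rightarrow> 'a \<Rightarrow> 'a) \<Rightarrow> ('a \<Rightarrow> 'a \<Rightarrow> 'a) \<Rightarrow> bool" where
  "two_cocycle scale mul \<phi> \<longleftrightarrow> bilinear_map scale \<phi> \<and> delta2 mul \<phi> = (\<lambda>x y z. 0)"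


subsection \<open>Sanity checks\<close>

lemma sum_triangle_swap:
  fixes h :: "nat \<Rightarrow> nat \<Rightarrow> 'a::comm_monoid_add"
  shows "(\<Sum>i=0..n. \<Sum>j=0..n - i. h i j) = (\<Sum>j=0..n. \<Sum>i=0..n - j. h i j)"
proof -
  have "(\<Sum>i=0..n. \<Sum>j=0..n - i. h i j) = (\<Sum>i\<in>{0..n}. \<Sum>j\<in>{j\<in>{0..n}. i + j \<le> n}. h i j)"
    by (intro sum.cong refl) auto
  also have "\<dots> = (\<Sum>j\<in>{0..n}. \<Sum>i\<in>{i\<in>{0..n}. i + j \<le> n}. h i j)"
    by (rule sum.swap_restrict) auto
  also have "\<dots> = (\<Sum>j=0..n. \<Sum>i=0..n - j. h i j)"
    by (intro sum.cong refl) auto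
  finally show ?thesis .
qed

lemma module_fps_scale:
  assumes "module scale"
  shows "module (fps_scale scale)"
proof -
  interpret module scale by fact
  show ?thesis
  proof
    fix a b :: "'a fps" and x y :: "'b fps"
    show "fps_scale scale a (x + y) = fps_scale scale a x + fps_scale scale a y"
      by (simp add: fps_scale_def fps_eq_iff scale_right_distrib sum.distrib)
    show "fps_scale scale (a + b) x = fps_scale scale a x + fps_scale scale b x"
      by (simp add: fps_scale_def fps_eq_iff scale_left_distrib sum.distrib)
    show "fps_scale scale a (fps_scale scale b x) = fps_scale scale (a * b) x"
      using fps_mult_assoc_lemma[of "\<lambda>i j k. scale (fps_nth a i * fps_nth b j) (fps_nth x k)"]
      by (simp add: fps_scale_def fps_eq_iff fps_mult_nth scale_sum_left scale_sum_right)
    show "fps_scale scale 1 x = x"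
      by (simp add: fps_scale_def fps_eq_iff if_distrib[of "\<lambda>c. scale c _"] cong: if_cong)
  qed
qed

lemma fps_extension_flip:
  "fps_extension B f g = fps_extension (\<lambda>x y. B y x) g f"
  unfolding fps_extension_def fps_eq_iff fps_nth_Abs_fps
  by (subst sum.atLeastAtMost_rev) (auto intro!: sum.cong)

lemma module_hom_fps_extension:
  fixes scale :: "'r::comm_ring_1 \<Rightarrow> 'a::ab_group_add \<Rightarrow> 'a"
  assumes "\<And>y. module_hom scale scale (\<lambda>x. B x y)"
  shows "module_hom (fps_scale scale) (fps_scale scale) (\<lambda>f. fps_extension B f g)"
proof -
  interpret module scale using assms by (simp add: module_hom_def)
  interpret fps: module "fps_scale scale" by (rule module_fps_scale) unfold_locales
  have sum: "B (sum h S) y = (\<Sum>i\<in>S. B (h i) y)" for h :: "nat \<Rightarrow> _" and S y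
    using module_hom.sum[OF assms] .
  show ?thesis
  proof
    fix f f' :: "'a fps" and c :: "'r fps"
    show "fps_extension B (f + f') g = fps_extension B f g + fps_extension B f' g"
      by (simp add: fps_extension_def fps_eq_iff module_hom.add[OF assms] sum.distrib)
    show "fps_extension B (fps_scale scale c f) g = fps_scale scale c (fps_extension B f g)"
      using fps_mult_assoc_lemma[of "\<lambda>i j k. scale (fps_nth c i) (B (fps_nth f j) (fps_nth g k))"]
      by (simp add: fps_extension_def fps_scale_def fps_eq_iff sum module_hom.scale[OF assms]
            scale_sum_right)
  qed
qed

lemma bilinear_map_fps_extension:
  assumes "bilinear_map scale B"
  shows "bilinear_map (fps_scale scale) (fps_extension B)"
  using assms module_hom_fps_extension[of scale B] module_hom_fps_extension[of scale "\<lambda>x y. B y x"]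
  by (simp add: bilinear_map_def fps_extension_flip[of B, symmetric])

lemma module_hom_fps_series:
  assumes "\<And>i. module_hom (fps_scale scale) (fps_scale scale) (F i)" "module scale"
  shows "module_hom (fps_scale scale) (fps_scale scale)
           (\<lambda>f. Abs_fps (\<lambda>n. \<Sum>i=0..n. fps_nth (F i f) (n - i)))"
proof -
  interpret module scale by fact
  interpret fps: module "fps_scale scale" by (rule module_fps_scale) unfold_locales
  show ?thesis
  proof (unfold_locales, goal_cases)
    case 1
    then show ?case by (simp add: fps_eq_iff module_hom.add[OF assms(1)] sum.distrib)
  next
    case (2 c f)
    have "(\<Sum>i=0..n. fps_nth (F i (fps_scale scale c f)) (n - i)) =
          (\<Sum>i=0..n. scale (fps_nth c i) (\<Sum>j=0..n - i. fps_nth (F j f) (n - i - j)))" for n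
      using sum_triangle_swap[of "\<lambda>i j. scale (fps_nth c j) (fps_nth (F i f) (n - i - j))" n]
      by (simp add: module_hom.scale[OF assms(1)] scale_sum_right)
        (simp add: fps_scale_def add.commute)
    then show ?case
      by (simp add: fps_eq_iff) (simp add: fps_scale_def)
  qed
qed

lemma bilinear_map_fps_bilinear_series:
  assumes "\<And>i. bilinear_map scale (\<mu> i)"
  shows "bilinear_map (fps_scale scale) (fps_bilinear_series \<mu>)"
proof -
  have "module scale"
    using assms[of 0] by (simp add: bilinear_map_def module_hom_def)
  then show ?thesis
    using bilinear_map_fps_extension[OF assms]
    unfolding bilinear_map_def fps_bilinear_series_def by (auto intro: module_hom_fps_series)
qed

end

theory Submission
  imports Defs
begin

lemma bilinear_map_zero:
  assumes "bilinear_map scale B"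
  shows "B 0 y = 0" "B x 0 = 0"
  using assms by (auto simp: bilinear_map_def dest: module_hom.zero)

text \<open>A constant series has zero coefficients beyond index 0, and \<open>B\<close> kills a
  zero first argument, so only \<open>j = 0\<close> contributes to the convolution.\<close>

lemma fps_extension_const_left:
  assumes "\<And>y. B 0 y = 0"
  shows "fps_nth (fps_extension B (fps_const a) g) n = B a (fps_nth g n)"
proof -
  have "(\<Sum>j=0..n. B (fps_nth (fps_const a) j) (fps_nth g (n - j))) =
        (\<Sum>j=0..n. if j = 0 then B a (fps_nth g n) else 0)"
    by (rule sum.cong) (auto simp: assms)
  then show ?thesis
    by (simp add: fps_extension_def)
qed

lemma fps_extension_const_right:
  assumes "\<And>x. B x 0 = 0"
  shows "fps_nth (fps_extension B f (fps_const b)) n = B (fps_nth f n) b"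
  by (subst fps_extension_flip) (simp add: fps_extension_const_left assms)

lemma fps_bilinear_series_const_left:
  assumes "\<And>i. bilinear_map scale (\<mu> i)"
  shows "fps_nth (fps_bilinear_series \<mu> (fps_const a) g) n = (\<Sum>i=0..n. \<mu> i a (fps_nth g (n - i)))"
  by (simp add: fps_bilinear_series_def fps_extension_const_left bilinear_map_zero[OF assms])

lemma fps_bilinear_series_const_right:
  assumes "\<And>i. bilinear_map scale (\<mu> i)"
  shows "fps_nth (fps_bilinear_series \<mu> f (fps_const b)) n = (\<Sum>i=0..n. \<mu> i (fps_nth f (n - i)) b)"
  by (simp add: fps_bilinear_series_def fps_extension_const_right bilinear_map_zero[OF assms])

text \<open>With both arguments constant, the inner coefficient of index \<open>n - i\<close> is
  nonzero only for \<open>i = n\<close>. This evaluates the inner products of the deformation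
  equation; the outer ones have just one constant argument.\<close>

lemma fps_bilinear_series_const_const:
  assumes "\<And>i. bilinear_map scale (\<mu> i)"
  shows "fps_nth (fps_bilinear_series \<mu> (fps_const a) (fps_const b)) n = \<mu> n a b"
proof -
  have "(\<Sum>i=0..n. \<mu> i a (fps_nth (fps_const b) (n - i))) =
        (\<Sum>i=0..n. if i = n then \<mu> n a b else 0)"
    by (rule sum.cong) (auto simp: bilinear_map_zero[OF assms])
  then show ?thesis
    by (simp add: fps_bilinear_series_const_left[OF assms])
qed

text \<open>To be applied with \<open>h i\<close> a composite of \<open>\<mu> i\<close> and
  \<open>\<mu> (p - i)\<close>. The bound \<open>p \<ge> 1\<close> keeps the indices 0 and
  \<open>p\<close> distinct, so that \<open>h 0\<close> is not counted twice.\<close>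

lemma sum_eq_endpoints:
  fixes h :: "nat \<Rightarrow> 'a::comm_monoid_add"
  assumes "p \<ge> 1" and "\<And>i. 1 \<le> i \<Longrightarrow> i < p \<Longrightarrow> h i = 0"
  shows "(\<Sum>i=0..p. h i) = h 0 + h p"
proof -
  have "sum h {0, p} = sum h {0..p}"
    by (rule sum.mono_neutral_left) (use assms in auto)
  then show ?thesis
    using assms(1) by simp
qed

text \<open>
  The coefficient of \<open>t\<^sup>p\<close> in the deformation equation is
  \<open>\<Sum>\<^sub>i \<mu>\<^sub>i(x, \<mu>\<^sub>p\<^sub>-\<^sub>i(y, z)) - \<mu>\<^sub>i(\<mu>\<^sub>p\<^sub>-\<^sub>i(x, y), z)\<close> symmetrized in \<open>x\<close> and \<open>y\<close>. Only the terms
  \<open>i = 0\<close> and \<open>i = p\<close> survive, and they add up to \<open>- \<delta>\<^sup>2 \<mu>\<^sub>p\<close>.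
\<close>

theorem theorem5p2:
  fixes scale :: "'k::{alg_closed_field, field_char_0} \<Rightarrow> 'a::ab_group_add \<Rightarrow> 'a"
    and mul :: "'a \<Rightarrow> 'a \<Rightarrow> 'a"
    and \<mu> :: "nat \<Rightarrow> 'a \<Rightarrow> 'a \<Rightarrow> 'a"
    and \<mu>t :: "'a fps \<Rightarrow> 'a fps \<Rightarrow> 'a fps"
    and p :: nat
  assumes "left_alternative_algebra scale mul"
    and "formal_left_alternative_deformation scale mul \<mu> \<mu>t"
    and "p \<ge> 1"
    and "\<And>i. 1 \<le> i \<Longrightarrow> i < p \<Longrightarrow> \<mu> i = (\<lambda>x y. 0)"
    and "\<mu> p \<noteq> (\<lambda>x y. 0)"
  shows "two_cocycle scale mul (\<mu> p)"
proof -
  have bil: "\<And>i. bilinear_map scale (\<mu> i)"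
    and \<mu>t: "\<mu>t = fps_bilinear_series \<mu>" and \<mu>0: "\<mu> 0 = mul"
    and eq: "\<mu>t (fps_const a) (\<mu>t (fps_const b) (fps_const c))
      - \<mu>t (\<mu>t (fps_const a) (fps_const b)) (fps_const c)
      + \<mu>t (fps_const b) (\<mu>t (fps_const a) (fps_const c))
      - \<mu>t (\<mu>t (fps_const b) (fps_const a)) (fps_const c) = 0" for a b c
    using assms(2) by (auto simp: formal_left_alternative_deformation_def Let_def)
  have mul_zero: "mul 0 a = 0" "mul a 0 = 0" for a
    using bilinear_map_zero[OF bil[of 0]] by (simp_all add: \<mu>0)
  \<comment> \<open>The index \<open>i\<close> of the outer map is 0 in the first summand and
    \<open>p\<close> in the second, where the inner map is \<open>\<mu> 0 = mul\<close>.\<close>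
  have left: "fps_nth (\<mu>t (fps_const a) (\<mu>t (fps_const b) (fps_const c))) p =
      mul a (\<mu> p b c) + \<mu> p a (mul b c)" for a b c
    using assms(3,4)
    by (simp add: \<mu>t fps_bilinear_series_const_left[OF bil]
        fps_bilinear_series_const_const[OF bil] sum_eq_endpoints \<mu>0 mul_zero)
  have right: "fps_nth (\<mu>t (\<mu>t (fps_const a) (fps_const b)) (fps_const c)) p =
      mul (\<mu> p a b) c + \<mu> p (mul a b) c" for a b c
    using assms(3,4)
    by (simp add: \<mu>t fps_bilinear_series_const_right[OF bil]
        fps_bilinear_series_const_const[OF bil] sum_eq_endpoints \<mu>0 mul_zero)
  have "delta2 mul (\<mu> p) a b c = 0" for a b c
  proof -
    have "mul a (\<mu> p b c) + \<mu> p a (mul b c) - (mul (\<mu> p a b) c + \<mu> p (mul a b) c)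
      + (mul b (\<mu> p a c) + \<mu> p b (mul a c)) - (mul (\<mu> p b a) c + \<mu> p (mul b a) c) = 0"
      using arg_cong[OF eq, of "\<lambda>f. fps_nth f p" a b c] by (simp add: left right)
    \<comment> \<open>The sign appears because the deformation equation is built from a(bc) - (ab)c,
      whereas \<open>delta2\<close> takes (ab)c - a(bc).\<close>
    then have "- delta2 mul (\<mu> p) a b c = 0"
      by (simp add: delta2_def comp_id_plus_sigma1_def algebra_simps)
    then show ?thesis by simp
  qed
  with bil show ?thesis
    by (simp add: two_cocycle_def fun_eq_iff)
qed

end
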